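(* Let $L$ be a residuated lattice satisfying the descending chain condition on filters. Then the canonical map $$\Phi:\mathcal F(L)\longrightarrow ZLTRL(L),\qquad F\longmapsto (L,\mathcal T_F),$$ from the set of filters of $L$ to the set of zero-dimensional linear topological residuated lattices on $L$, is bijective.
   Context: A residuated lattice is an algebra $(L,\wedge,\vee,\odot,\rightarrow,0,1)$ such that $(L,\wedge,\vee,0,1)$ is a bounded lattice, $(L,\odot,1)$ is a commutative monoid, and $x\odot y\leq z$ iff $x\leq y\rightarrow z$ for all $x,y,z\in L$. A filter of $L$ is a nonempty subset $F\subseteq L$ closed under $\odot$ and upward closed; $\mathcal F(L)$ is the set of all filters. $L$ satisfies the descending chain condition if every strictly descending chain of filters of $L$ is finite. For a filter $F$, $x/F=\{y\in L:(x\to y)\odot(y\to x)\in F\}$ and $\mathcal T_F=\{U\subseteq L:\forall x\in U,\ x/F\subseteq U\}$. A topological residuated lattice is a residuated lattice with a topology making all operations continuous. A topology on $L$ is linear if it has a base $\beta$ such that, for all $B\in\beta$, $B$ is a filter if and only if $1\in B$. A topology is zero-dimensional if it has a base of clopen sets. $ZLTRL(L)$ denotes the set of all topological residuated lattices $(L,\mathcal U)$ on the given residuated lattice $L$ such that $\mathcal U$ is linear and zero-dimensional. *)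

theory Defs
  imports "HOL-Analysis.Analysis"
begin

text \<open>The monoid unit is the top element of the lattice; \<open>0\<close> is \<open>bot\<close>, and \<open>\<odot>\<close> is written \<open>*\<close>.
  The case \<open>bot = top\<close> (a one-element algebra) is allowed.\<close>

class residuated_lattice = bounded_lattice + comm_monoid_mult +
  fixes residuum :: "'a \<Rightarrow> 'a \<Rightarrow> 'a"  (infixr "\<rightharpoonup>" 60)
  assumes one_eq_top: "1 = top"
    and residuation: "x * y \<le> z \<longleftrightarrow> x \<le> y \<rightharpoonup> z"

definition is_rl_filter :: "'a::residuated_lattice set \<Rightarrow> bool" where
  "is_rl_filter F \<longleftrightarrow>
     F \<noteq> {} \<and> (\<forall>x\<in>F. \<forall>y\<in>F. x * y \<in> F) \<and> (\<forall>x\<in>F. \<forall>y. x \<le> y \<longrightarrow> y \<in> F)"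

definition rl_filters :: "'a::residuated_lattice set set" where
  "rl_filters = {F. is_rl_filter F}"

definition descending_chain_condition :: "'a set set \<Rightarrow> bool" where
  "descending_chain_condition \<F> \<longleftrightarrow>
     \<not> (\<exists>C :: nat \<Rightarrow> 'a set. (\<forall>n. C n \<in> \<F>) \<and> (\<forall>n. C (Suc n) \<subset> C n))"

definition filter_class :: "'a::residuated_lattice \<Rightarrow> 'a set \<Rightarrow> 'a set" where
  "filter_class x F = {y. (x \<rightharpoonup> y) * (y \<rightharpoonup> x) \<in> F}"

definition filter_opens :: "'a::residuated_lattice set \<Rightarrow> 'a set set" where
  "filter_opens F = {U. \<forall>x\<in>U. filter_class x F \<subseteq> U}"

definition filter_topology :: "'a::residuated_lattice set \<Rightarrow> 'a topology" where
  "filter_topology F = topology (\<lambda>U. U \<in> filter_opens F)"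

lemma istopology_filter_opens: "istopology (\<lambda>U. U \<in> filter_opens F)"
  unfolding istopology_def filter_opens_def by blast

lemma openin_filter_topology: "openin (filter_topology F) U \<longleftrightarrow> U \<in> filter_opens F"
  by (simp add: filter_topology_def topology_inverse'[OF istopology_filter_opens])

lemma topspace_filter_topology: "topspace (filter_topology F) = UNIV"
proof -
  have "openin (filter_topology F) UNIV"
    by (simp add: openin_filter_topology filter_opens_def)
  then show ?thesis
    using openin_subset by blast
qed

definition topology_base :: "'a topology \<Rightarrow> 'a set set \<Rightarrow> bool" where
  "topology_base T \<B> \<longleftrightarrow> openin T = arbitrary union_of (\<lambda>B. B \<in> \<B>)"

definition linear_topology :: "'a::residuated_lattice topology \<Rightarrow> bool" where
  "linear_topology T \<longleftrightarrow>
     (\<exists>\<B>. topology_base T \<B> \<and> (\<forall>B\<in>\<B>. is_rl_filter B \<longleftrightarrow> 1 \<in> B))"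

definition zero_dimensional :: "'a topology \<Rightarrow> bool" where
  "zero_dimensional T \<longleftrightarrow>
     (\<exists>\<B>. topology_base T \<B> \<and> (\<forall>B\<in>\<B>. openin T B \<and> closedin T B))"

text \<open>No separation axiom is imposed. The nullary operations are trivially continuous.\<close>

definition topological_residuated_lattice :: "'a::residuated_lattice topology \<Rightarrow> bool" where
  "topological_residuated_lattice T \<longleftrightarrow>
     topspace T = UNIV \<and>
     continuous_map (prod_topology T T) T (\<lambda>(x, y). inf x y) \<and>
     continuous_map (prod_topology T T) T (\<lambda>(x, y). sup x y) \<and>
     continuous_map (prod_topology T T) T (\<lambda>(x, y). x * y) \<and>
     continuous_map (prod_topology T T) T (\<lambda>(x, y). x \<rightharpoonup> y)"

text \<open>The algebra is the type \<open>'a\<close>, so a topological residuated lattice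
  \<open>(L, T)\<close> on it is determined by, and identified with, its topology \<open>T\<close>.\<close>

definition ZLTRL :: "'a::residuated_lattice topology set" where
  "ZLTRL = {T. topological_residuated_lattice T \<and> linear_topology T \<and> zero_dimensional T}"

end

theory Submission
  imports Defs
begin

text \<open>\<open>\<T>\<^sub>F\<close> is the partition topology of the congruence given by \<open>F\<close>, and \<open>F\<close> is recovered as the
  least open set containing \<open>1\<close>. Conversely, for a linear zero-dimensional topology, the chain
  condition yields a least open filter \<open>F\<close>; by linearity every neighbourhood of \<open>1\<close> contains \<open>F\<close>,
  and clopen sets then cannot separate elements of \<open>F\<close> from \<open>1\<close>. Continuous operations preserve
  topological indistinguishability, so for \<open>x\<close>, \<open>y\<close> congruent modulo \<open>F\<close> the point
  \<open>y = x * (x \<rightharpoonup> y) \<squnion> y\<close> is indistinguishable from \<open>x * 1 \<squnion> y = x \<squnion> y\<close>, and so, by symmetry, is \<open>x\<close>.\<close>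

section \<open>Residuated lattices and congruences modulo filters\<close>

context residuated_lattice
begin

lemma le_one: "x \<le> 1"
  by (simp add: one_eq_top)

lemma mult_right_mono_rl:
  assumes "x \<le> y"
  shows "x * z \<le> y * z"
proof -
  have "y \<le> z \<rightharpoonup> y * z"
    by (simp flip: residuation)
  with assms have "x \<le> z \<rightharpoonup> y * z"
    by (rule order_trans)
  then show ?thesis
    by (simp add: residuation)
qed

lemma mult_mono_rl:
  assumes "x \<le> y" "u \<le> v"
  shows "x * u \<le> y * v"
proof -
  have "x * u \<le> y * u"
    using assms(1) by (rule mult_right_mono_rl)
  also have "y * u \<le> y * v"
    using mult_right_mono_rl[OF assms(2), of y] by (simp add: mult.commute)
  finally show ?thesis .
qed

lemma mult_le_left: "x * y \<le> x"
  using mult_mono_rl[OF order_refl le_one, of x y] by simp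

lemma mult_le_right: "x * y \<le> y"
  using mult_le_left[of y x] by (simp add: mult.commute)

lemma residuum_mult_le: "(x \<rightharpoonup> y) * x \<le> y"
  by (simp add: residuation)

lemma residuum_eq_one:
  assumes "x \<le> y"
  shows "x \<rightharpoonup> y = 1"
proof (rule order.antisym[OF le_one])
  show "1 \<le> x \<rightharpoonup> y"
    using assms by (simp flip: residuation)
qed

lemma residuum_one: "1 \<rightharpoonup> x = x"
proof (rule order.antisym)
  show "1 \<rightharpoonup> x \<le> x"
    using residuum_mult_le[of 1 x] by simp
  show "x \<le> 1 \<rightharpoonup> x"
    by (simp flip: residuation)
qed

text \<open>By residuation, multiplication by \<open>c\<close> is a left adjoint, so it preserves
  binary joins.\<close>

lemma mult_sup_le_iff: "c * sup x y \<le> z \<longleftrightarrow> c * x \<le> z \<and> c * y \<le> z"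
  by (simp add: mult.commute[of c] residuation)

end

section \<open>Basic facts on filters and on bases of topologies\<close>

lemma rl_filterD:
  assumes "is_rl_filter F"
  shows one_mem_rl_filter: "1 \<in> F"
    and mult_mem_rl_filter: "x \<in> F \<Longrightarrow> y \<in> F \<Longrightarrow> x * y \<in> F"
    and up_mem_rl_filter: "x \<in> F \<Longrightarrow> x \<le> y \<Longrightarrow> y \<in> F"
proof -
  have "F \<noteq> {}"
    using assms by (simp add: is_rl_filter_def)
  then obtain x where "x \<in> F"
    by auto
  then show "1 \<in> F"
    using assms le_one[of x] unfolding is_rl_filter_def by blast
qed (use assms in \<open>auto simp: is_rl_filter_def\<close>)

text \<open>Trades the union form of a base for the pointwise form, in which bases are both
  established and exploited below.\<close>

lemma topology_base_iff:
  "topology_base T \<B> \<longleftrightarrow>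
    (\<forall>B\<in>\<B>. openin T B) \<and> (\<forall>U x. openin T U \<longrightarrow> x \<in> U \<longrightarrow> (\<exists>B\<in>\<B>. x \<in> B \<and> B \<subseteq> U))"
  by (simp add: topology_base_def openin_topology_base_unique Ball_def Bex_def imp_conjL)

text \<open>The preorder that induces the order of the quotient by \<open>F\<close>. With an
  explicit multiplier \<open>a\<close>, compatibility with the operations reduces to plain
  inequalities.\<close>

definition filter_le :: "'a::residuated_lattice set \<Rightarrow> 'a \<Rightarrow> 'a \<Rightarrow> bool" where
  "filter_le F x y \<longleftrightarrow> (\<exists>a\<in>F. a * x \<le> y)"

context
  fixes F :: "'a::residuated_lattice set"
  assumes F: "is_rl_filter F"
begin

text \<open>\<open>x \<rightharpoonup> y\<close> is the largest \<open>a\<close> with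
  \<open>a * x \<le> y\<close>, so by upward closure it is a multiplier in \<open>F\<close> as soon
  as there is one.\<close>

lemma filter_le_iff_residuum: "filter_le F x y \<longleftrightarrow> x \<rightharpoonup> y \<in> F"
  unfolding filter_le_def using up_mem_rl_filter[OF F] residuation residuum_mult_le by blast

text \<open>A product lies in \<open>F\<close> iff both factors do, because it lies below each of
  them. Hence classes are those of the symmetric part of the preorder.\<close>

lemma mem_filter_class_iff: "y \<in> filter_class x F \<longleftrightarrow> filter_le F x y \<and> filter_le F y x"
  unfolding filter_class_def filter_le_iff_residuum mem_Collect_eq
  using rl_filterD[OF F] mult_le_left mult_le_right by blast

lemma filter_le_refl: "filter_le F x x"
  by (simp add: filter_le_iff_residuum residuum_eq_one one_mem_rl_filter[OF F])

lemma filter_le_trans: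
  assumes "filter_le F x y" "filter_le F y z"
  shows "filter_le F x z"
proof -
  obtain a b where ab: "a \<in> F" "b \<in> F" "a * x \<le> y" "b * y \<le> z"
    using assms unfolding filter_le_def by blast
  then have "(b * a) * x \<le> z"
    by (metis mult.assoc mult_mono_rl order_refl order_trans)
  then show ?thesis
    unfolding filter_le_def using ab mult_mem_rl_filter[OF F] by blast
qed

lemma filter_class_refl: "x \<in> filter_class x F"
  by (simp add: mem_filter_class_iff filter_le_refl)

lemma filter_class_sym: "y \<in> filter_class x F \<Longrightarrow> x \<in> filter_class y F"
  by (simp add: mem_filter_class_iff)

lemma filter_class_trans:
  "y \<in> filter_class x F \<Longrightarrow> z \<in> filter_class y F \<Longrightarrow> z \<in> filter_class x F"
  using filter_le_trans by (auto simp: mem_filter_class_iff)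

lemma filter_class_eq:
  assumes "y \<in> filter_class x F"
  shows "filter_class y F = filter_class x F"
  using assms filter_class_sym filter_class_trans by blast

lemma filter_class_one: "filter_class 1 F = F"
  by (simp add: filter_class_def residuum_one residuum_eq_one le_one)

text \<open>The product \<open>a * b\<close> of the two given multipliers serves for all four
  operations. The residuum is antitone in its first argument, hence the swapped \<open>x\<close> and
  \<open>y\<close> there.\<close>

lemma filter_le_mono:
  assumes "filter_le F x y" "filter_le F u v"
  shows filter_le_mult: "filter_le F (x * u) (y * v)"
    and filter_le_inf: "filter_le F (inf x u) (inf y v)"
    and filter_le_sup: "filter_le F (sup x u) (sup y v)"
    and filter_le_residuum: "filter_le F (y \<rightharpoonup> u) (x \<rightharpoonup> v)"
proof -
  obtain a b where ab: "a \<in> F" "b \<in> F" "a * x \<le> y" "b * u \<le> v"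
    using assms unfolding filter_le_def by blast
  have abF: "a * b \<in> F"
    using ab mult_mem_rl_filter[OF F] by blast
  have x: "(a * b) * x \<le> y"
    using ab(3) by (meson mult_le_left mult_right_mono_rl order_trans)
  have u: "(a * b) * u \<le> v"
    using ab(4) by (meson mult_le_right mult_right_mono_rl order_trans)
  have "(a * b) * (x * u) \<le> y * v"
    using mult_mono_rl[OF ab(3,4)] by (simp add: ac_simps)
  then show "filter_le F (x * u) (y * v)"
    unfolding filter_le_def using abF by blast
  have "(a * b) * inf x u \<le> inf y v"
    using x u by (meson inf_le1 inf_le2 le_infI mult_mono_rl order_refl order_trans)
  then show "filter_le F (inf x u) (inf y v)"
    unfolding filter_le_def using abF by blast
  have "(a * b) * sup x u \<le> sup y v"
    using x u by (simp add: mult_sup_le_iff le_supI1 le_supI2)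
  then show "filter_le F (sup x u) (sup y v)"
    unfolding filter_le_def using abF by blast
  \<comment> \<open>Since \<open>a * x \<le> y\<close>, modus ponens bounds the inner product by
    \<open>u\<close>, and \<open>b\<close> carries \<open>u\<close> below \<open>v\<close>.\<close>
  have "b * ((y \<rightharpoonup> u) * (a * x)) \<le> v"
    by (meson ab(3,4) mult_mono_rl order_refl order_trans residuum_mult_le)
  then have "(a * b) * (y \<rightharpoonup> u) \<le> x \<rightharpoonup> v"
    by (simp add: residuation[symmetric] ac_simps)
  then show "filter_le F (y \<rightharpoonup> u) (x \<rightharpoonup> v)"
    unfolding filter_le_def using abF by blast
qed

lemma filter_class_cong:
  assumes "y \<in> filter_class x F" "v \<in> filter_class u F"
  shows "inf y v \<in> filter_class (inf x u) F" "sup y v \<in> filter_class (sup x u) F"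
    "y * v \<in> filter_class (x * u) F" "y \<rightharpoonup> v \<in> filter_class (x \<rightharpoonup> u) F"
  using assms by (simp_all add: mem_filter_class_iff filter_le_mono)

section \<open>The topology of a filter\<close>

lemma openin_filter_class: "openin (filter_topology F) (filter_class x F)"
  unfolding openin_filter_topology filter_opens_def using filter_class_eq by blast

text \<open>The classes partition the lattice, so the complement of a class is again a union of
  classes.\<close>

lemma closedin_filter_class: "closedin (filter_topology F) (filter_class x F)"
  unfolding closedin_def topspace_filter_topology openin_filter_topology filter_opens_def
  using filter_class_sym filter_class_trans by blast

lemma topology_base_filter_classes:
  "topology_base (filter_topology F) (range (\<lambda>x. filter_class x F))"
  unfolding topology_base_iff
proof (intro conjI ballI allI impI)
  fix U x
  assume "openin (filter_topology F) U" "x \<in> U"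
  then have "filter_class x F \<subseteq> U"
    by (simp add: openin_filter_topology filter_opens_def)
  then show "\<exists>B\<in>range (\<lambda>x. filter_class x F). x \<in> B \<and> B \<subseteq> U"
    using filter_class_refl by blast
qed (auto simp: openin_filter_class)

text \<open>A congruence sends a product of two classes into one class, and such products are open
  boxes; this gives joint continuity.\<close>

lemma continuous_map_filter_topology:
  assumes "\<And>x y u v. y \<in> filter_class x F \<Longrightarrow> v \<in> filter_class u F \<Longrightarrow>
    f y v \<in> filter_class (f x u) F"
  shows "continuous_map (prod_topology (filter_topology F) (filter_topology F))
    (filter_topology F) (\<lambda>(x, y). f x y)"
  unfolding continuous_map_def
proof (intro conjI allI impI)
  fix U
  assume U: "openin (filter_topology F) U"
  have "\<exists>V W. openin (filter_topology F) V \<and> openin (filter_topology F) W \<and>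
      x \<in> V \<and> u \<in> W \<and> V \<times> W \<subseteq> {p. (\<lambda>(x, y). f x y) p \<in> U}" if "f x u \<in> U" for x u
  proof (intro exI conjI)
    show "filter_class x F \<times> filter_class u F \<subseteq> {p. (\<lambda>(x, y). f x y) p \<in> U}"
    proof clarsimp
      fix y v
      assume "y \<in> filter_class x F" "v \<in> filter_class u F"
      with assms have "f y v \<in> filter_class (f x u) F" .
      then show "f y v \<in> U"
        using that U unfolding openin_filter_topology filter_opens_def by blast
    qed
  qed (rule openin_filter_class filter_class_refl)+
  then show "openin (prod_topology (filter_topology F) (filter_topology F))
      {p \<in> topspace (prod_topology (filter_topology F) (filter_topology F)).
        (\<lambda>(x, y). f x y) p \<in> U}"
    by (auto simp: openin_prod_topology_alt topspace_filter_topology)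
qed (simp add: topspace_filter_topology)

lemma filter_topology_in_ZLTRL: "filter_topology F \<in> ZLTRL"
proof -
  \<comment> \<open>A class containing \<open>1\<close> is the class of \<open>1\<close>, which is
    \<open>F\<close> itself.\<close>
  have "is_rl_filter (filter_class x F) \<longleftrightarrow> 1 \<in> filter_class x F" for x
    using F filter_class_eq filter_class_one one_mem_rl_filter by metis
  then have "linear_topology (filter_topology F)"
    unfolding linear_topology_def using topology_base_filter_classes by blast
  moreover have "zero_dimensional (filter_topology F)"
    unfolding zero_dimensional_def
    using topology_base_filter_classes openin_filter_class closedin_filter_class by blast
  ultimately show ?thesis
    by (simp add: ZLTRL_def topological_residuated_lattice_def topspace_filter_topology
        continuous_map_filter_topology filter_class_cong)
qed

lemma filter_subset_open:
  assumes "openin (filter_topology F) U" "1 \<in> U"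
  shows "F \<subseteq> U"
  using assms filter_class_one unfolding openin_filter_topology filter_opens_def by blast

lemma openin_filter: "openin (filter_topology F) F"
  using openin_filter_class[of 1] by (simp add: filter_class_one)

end

lemma inj_on_filter_topology: "inj_on filter_topology (rl_filters :: 'a::residuated_lattice set set)"
proof (rule inj_onI)
  fix F G :: "'a set"
  assume F: "F \<in> rl_filters" and G: "G \<in> rl_filters"
    and eq: "filter_topology F = filter_topology G"
  \<comment> \<open>\<open>G\<close> is open and contains \<open>1\<close>, so it includes
    \<open>F\<close>. The claim is generalized over both filters so that it also yields the reverse
    inclusion.\<close>
  have "F \<subseteq> G" if "is_rl_filter F" "is_rl_filter G" "filter_topology F = filter_topology G"
    for F G :: "'a set"
    using filter_subset_open[OF that(1), of G] openin_filter[OF that(2)] that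
    by (simp add: one_mem_rl_filter)
  with F G eq show "F = G"
    by (simp add: rl_filters_def subset_antisym)
qed

section \<open>Linear zero-dimensional topologies\<close>

lemma is_rl_filter_Int:
  assumes "is_rl_filter F" "is_rl_filter G"
  shows "is_rl_filter (F \<inter> G)"
proof -
  have "1 \<in> F \<inter> G"
    using assms by (simp add: one_mem_rl_filter)
  then show ?thesis
    using assms by (auto simp: is_rl_filter_def)
qed

text \<open>Without a minimal member, dependent choice would build an infinite strictly descending
  chain.\<close>

lemma dcc_minimal:
  assumes "descending_chain_condition \<F>" "\<A> \<subseteq> \<F>" "A \<in> \<A>"
  obtains M where "M \<in> \<A>" "\<And>N. N \<in> \<A> \<Longrightarrow> \<not> N \<subset> M"
proof -
  have "\<exists>M\<in>\<A>. \<forall>N\<in>\<A>. \<not> N \<subset> M"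
  proof (rule ccontr)
    assume "\<not> ?thesis"
    then have "\<exists>Y. Y \<in> \<A> \<and> Y \<subset> X" if "X \<in> \<A>" for X
      using that by auto
    then have "\<exists>C. \<forall>n. C n \<in> \<A> \<and> C (Suc n) \<subset> C n"
      using assms(3)
      by (intro dependent_nat_choice[of "\<lambda>_ X. X \<in> \<A>" "\<lambda>_ X Y. Y \<subset> X"]) auto
    then obtain C where C: "\<forall>n. C n \<in> \<A> \<and> C (Suc n) \<subset> C n" ..
    then have "\<forall>n. C n \<in> \<F>"
      using assms(2) by auto
    then show False
      using assms(1) C unfolding descending_chain_condition_def by metis
  qed
  then show thesis
    using that by auto
qed

lemma least_open_filter:
  fixes T :: "'a::residuated_lattice topology"
  assumes dcc: "descending_chain_condition (rl_filters :: 'a set set)"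
    and top: "topspace T = UNIV"
  obtains F where "is_rl_filter F" "openin T F"
    "\<And>G. is_rl_filter G \<Longrightarrow> openin T G \<Longrightarrow> F \<subseteq> G"
proof -
  let ?A = "{G. is_rl_filter G \<and> openin T G}"
  have "UNIV \<in> ?A"
    using openin_topspace[of T] by (simp add: is_rl_filter_def top)
  moreover have "?A \<subseteq> rl_filters"
    by (auto simp: rl_filters_def)
  ultimately obtain F where F: "F \<in> ?A" and min: "\<And>N. N \<in> ?A \<Longrightarrow> \<not> N \<subset> F"
    using dcc_minimal[OF dcc] by blast
  \<comment> \<open>Open filters are closed under binary intersection, so minimality of
    \<open>F\<close> makes it least.\<close>
  have "F \<subseteq> G" if "is_rl_filter G" "openin T G" for G
    using min[of "F \<inter> G"] F that is_rl_filter_Int by blast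
  then show thesis
    using that F by blast
qed

section \<open>Separate continuity and topological indistinguishability\<close>

lemma continuous_map_slices:
  assumes "continuous_map (prod_topology T T) T (\<lambda>(x, y). f x y)" "topspace T = UNIV"
  shows "continuous_map T T (f a)" "continuous_map T T (\<lambda>x. f x a)"
proof -
  have "continuous_map T (prod_topology T T) (\<lambda>x. (a, x))"
    "continuous_map T (prod_topology T T) (\<lambda>x. (x, a))"
    using assms(2) by (auto simp: continuous_map_pairwise o_def)
  from this[THEN continuous_map_compose, OF assms(1)]
  show "continuous_map T T (f a)" "continuous_map T T (\<lambda>x. f x a)"
    by (simp_all add: o_def)
qed

text \<open>The relation whose quotient is the Kolmogorov quotient. It need not be equality, as no
  separation axiom is imposed.\<close>

definition indistinguishable :: "'a topology \<Rightarrow> 'a \<Rightarrow> 'a \<Rightarrow> bool" where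
  "indistinguishable T x y \<longleftrightarrow> (\<forall>U. openin T U \<longrightarrow> (x \<in> U \<longleftrightarrow> y \<in> U))"

lemma indistinguishable_continuous_map:
  assumes "indistinguishable T x y" "continuous_map T T f" "topspace T = UNIV"
  shows "indistinguishable T (f x) (f y)"
  unfolding indistinguishable_def
proof (intro allI impI)
  fix U
  assume "openin T U"
  then have "openin T {z. f z \<in> U}"
    using assms(2,3) by (simp add: continuous_map_def)
  then show "f x \<in> U \<longleftrightarrow> f y \<in> U"
    using assms(1) unfolding indistinguishable_def by blast
qed

lemma ZLTRL_eq_filter_topology:
  fixes T :: "'a::residuated_lattice topology"
  assumes dcc: "descending_chain_condition (rl_filters :: 'a set set)"
    and T: "T \<in> ZLTRL"
  obtains F where "is_rl_filter F" "T = filter_topology F"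
proof -
  have top: "topspace T = UNIV"
    and sup: "continuous_map (prod_topology T T) T (\<lambda>(x, y). sup x y)"
    and mult: "continuous_map (prod_topology T T) T (\<lambda>(x, y). x * y)"
    and res: "continuous_map (prod_topology T T) T (\<lambda>(x, y). x \<rightharpoonup> y)"
    and lin: "linear_topology T" and zd: "zero_dimensional T"
    using T by (auto simp: ZLTRL_def topological_residuated_lattice_def)
  obtain F where F: "is_rl_filter F" and opF: "openin T F"
    and least: "\<And>G. is_rl_filter G \<Longrightarrow> openin T G \<Longrightarrow> F \<subseteq> G"
    using least_open_filter[OF dcc top] by blast
  have nbhd_one: "F \<subseteq> U" if U: "openin T U" "1 \<in> U" for U
  proof -
    obtain \<B> where \<B>: "topology_base T \<B>" "\<forall>B\<in>\<B>. is_rl_filter B \<longleftrightarrow> 1 \<in> B"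
      using lin by (auto simp: linear_topology_def)
    \<comment> \<open>By linearity this basic neighbourhood of \<open>1\<close> is an open filter,
      so it lies above the least one.\<close>
    then obtain B where B: "B \<in> \<B>" "openin T B" "1 \<in> B" "B \<subseteq> U"
      using U unfolding topology_base_iff by blast
    then have "F \<subseteq> B"
      using least \<B>(2) by simp
    with B show ?thesis
      by blast
  qed
  have indist_one: "indistinguishable T f 1" if f: "f \<in> F" for f
  proof -
    have "1 \<in> U" if U: "openin T U" "f \<in> U" for U
    proof (rule ccontr)
      assume "1 \<notin> U"
      obtain \<B> where \<B>: "topology_base T \<B>" "\<forall>B\<in>\<B>. openin T B \<and> closedin T B"
        using zd by (auto simp: zero_dimensional_def)
      obtain B where B: "B \<in> \<B>" "f \<in> B" "B \<subseteq> U"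
        using \<B>(1) U unfolding topology_base_iff by blast
      \<comment> \<open>\<open>B\<close> misses \<open>1\<close>, so its complement is an open
        neighbourhood of \<open>1\<close>; it would have to include \<open>F\<close>, although
        \<open>f\<close> lies in \<open>B\<close>.\<close>
      have "openin T (- B)"
        using \<B>(2) B(1) top by (simp add: closedin_def Compl_eq_Diff_UNIV)
      then show False
        using nbhd_one[of "- B"] B \<open>1 \<notin> U\<close> f by blast
    qed
    then show ?thesis
      using nbhd_one f unfolding indistinguishable_def by blast
  qed
  have indist_sup: "indistinguishable T y (sup x y)" if "x \<rightharpoonup> y \<in> F" for x y
  proof -
    \<comment> \<open>This polynomial map is evaluated at the indistinguishable points
      \<open>x \<rightharpoonup> y\<close> and \<open>1\<close>. The first value collapses to
      \<open>y\<close> since \<open>(x \<rightharpoonup> y) * x \<le> y\<close>; the second is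
      \<open>sup x y\<close>.\<close>
    have "continuous_map T T (\<lambda>z. sup (z * x) y)"
      using continuous_map_compose[OF continuous_map_slices(2)[OF mult top, of x]
          continuous_map_slices(2)[OF sup top, of y]] by (simp add: o_def)
    from indistinguishable_continuous_map[OF indist_one[OF that] this top]
    show ?thesis
      by (simp add: sup_absorb2 residuum_mult_le)
  qed
  have indist: "indistinguishable T x y" if "y \<in> filter_class x F" for x y
  proof -
    have "x \<rightharpoonup> y \<in> F" "y \<rightharpoonup> x \<in> F"
      using that by (simp_all add: mem_filter_class_iff[OF F] filter_le_iff_residuum[OF F])
    then show ?thesis
      using indist_sup[of x y] indist_sup[of y x]
      by (simp add: indistinguishable_def sup_commute)
  qed
  have opclass: "openin T (filter_class x F)" for x
  proof -
    \<comment> \<open>The class is cut out by the preimages of the open set \<open>F\<close> under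
      the two slices of the residuum at \<open>x\<close>.\<close>
    have "filter_class x F = {y. x \<rightharpoonup> y \<in> F} \<inter> {y. y \<rightharpoonup> x \<in> F}"
      by (auto simp: mem_filter_class_iff[OF F] filter_le_iff_residuum[OF F])
    moreover have "openin T {y. x \<rightharpoonup> y \<in> F}" "openin T {y. y \<rightharpoonup> x \<in> F}"
      using continuous_map_slices[OF res top, of x] opF by (simp_all add: continuous_map_def top)
    ultimately show ?thesis
      by (metis openin_Int)
  qed
  have "T = filter_topology F"
  proof (rule topology_eq[THEN iffD2], intro allI iffI)
    fix U
    assume "openin T U"
    \<comment> \<open>Members of one class are indistinguishable, so a \<open>T\<close>-open set is
      a union of classes.\<close>
    then show "openin (filter_topology F) U"
      using indist unfolding openin_filter_topology filter_opens_def indistinguishable_def by blast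
  next
    fix U
    assume U: "openin (filter_topology F) U"
    \<comment> \<open>Conversely \<open>U\<close> is a union of classes, each of which is
      \<open>T\<close>-open.\<close>
    show "openin T U"
    proof (rule openin_subopen[THEN iffD2], rule ballI)
      fix x
      assume "x \<in> U"
      then have "filter_class x F \<subseteq> U"
        using U by (simp add: openin_filter_topology filter_opens_def)
      then show "\<exists>V. openin T V \<and> x \<in> V \<and> V \<subseteq> U"
        using opclass filter_class_refl[OF F] by blast
    qed
  qed
  then show thesis
    using that F by blast
qed

theorem theorem5p10:
  assumes "descending_chain_condition (rl_filters :: 'a::residuated_lattice set set)"
  shows "bij_betw filter_topology (rl_filters :: 'a set set) (ZLTRL :: 'a topology set)"
proof -
  have "filter_topology ` (rl_filters :: 'a set set) = ZLTRL"
  proof (intro subset_antisym subsetI)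
    fix T :: "'a topology"
    assume "T \<in> filter_topology ` rl_filters"
    then show "T \<in> ZLTRL"
      by (auto simp: rl_filters_def filter_topology_in_ZLTRL)
  next
    fix T :: "'a topology"
    assume "T \<in> ZLTRL"
    then obtain F where "is_rl_filter F" "T = filter_topology F"
      by (rule ZLTRL_eq_filter_topology[OF assms])
    then show "T \<in> filter_topology ` rl_filters"
      by (simp add: rl_filters_def)
  qed
  then show ?thesis
    by (simp add: bij_betw_def inj_on_filter_topology)
qed

end
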